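(* Each bottom-up tree transformation can be realized by a finite state relabeling followed by a tree homomorphism: $B\subseteq QREL\circ HOM$. Moreover, $LB\subseteq QREL\circ LHOM$ and $DB\subseteq DBQREL\circ HOM$.
   Context: Alphabets are finite. A ranked alphabet $\Sigma$ is a finite set of symbols with, for each $k\ge 0$, a subset $\Sigma_k$ (symbols of rank $k$; a symbol may have several ranks), $\Sigma=\bigcup_k\Sigma_k$, only finitely many $\Sigma_k$ nonempty. $T_\Sigma$ is the set of trees over $\Sigma$: $a\in T_\Sigma$ for $a\in\Sigma_0$, and $a[t_1\cdots t_k]\in T_\Sigma$ for $k\ge1$, $a\in\Sigma_k$, $t_i\in T_\Sigma$. A tree transformation from $T_\Sigma$ into $T_\Delta$ is a subset of $T_\Sigma\times T_\Delta$; maps $f:T_\Sigma\to T_\Delta$ are identified with their graphs $\{(s,t)\mid f(s)=t\}$. For $M_1\subseteq T_\Sigma\times T_\Delta$ and $M_2\subseteq T_\Delta\times T_\Omega$, $M_1\circ M_2=\{(s,t)\mid (s,u)\in M_1,(u,t)\in M_2\text{ for some }u\}$ ($M_1$ is applied first); $F\circ G=\{M_1\circ M_2\mid M_1\in F,M_2\in G\}$. Variables: $X_k=\{x_1,\dots,x_k\}$, $X_0=\emptyset$; $T_\Delta(X_k)$ is the set of trees over $\Delta\cup X_k$, variables having rank $0$. A tree homomorphism is a family of maps $h_k:\Sigma_k\to T_\Delta(X_k)$ ($k\ge 0$), determining $h:T_\Sigma\to T_\Delta$ by $h(a)=h_0(a)$ and $h(a[t_1\cdots t_k])=h_k(a)\langle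 x_1\gets h(t_1),\dots,x_k\gets h(t_k)\rangle$ (simultaneous substitution). It is linear if no $h_k(a)$ contains a variable twice. $HOM$, $LHOM$: classes of tree homomorphisms and linear tree homomorphisms. A bottom-up finite tree transducer is $M=(Q,\Sigma,\Delta,R,Q_d)$, where $Q$ is a finite set of states, regarded as symbols of rank $1$ only and disjoint from $\Sigma\cup\Delta$, $Q_d\subseteq Q$ (final states), and $R$ is a finite set of rules of the forms $a\to q[t]$ ($a\in\Sigma_0$, $q\in Q$, $t\in T_\Delta$) or $a[q_1[x_1]\cdots q_k[x_k]]\to q[t]$ ($k\ge1$, $a\in\Sigma_k$, $q_i,q\in Q$, $t\in T_\Delta(X_k)$). Rules rewrite trees over $Q\cup\Sigma\cup\Delta$: $s\Rightarrow s'$ if $s'$ is obtained from $s$ by replacing one occurrence of a subtree $v\langle x_1\gets\phi_1,\dots,x_k\gets\phi_k\rangle$ by $w\langle x_1\gets\phi_1,\dots,x_k\gets\phi_k\rangle$ for a rule $v\to w$ and some $\phi_i\in T_\Delta$. $M$ realizes $\{(s,t)\in T_\Sigma\times T_\Delta\mid s\Rightarrow^*q[t]\text{ for some }q\in Q_d\}$. $M$ is linear if no variable occurs more than once in the right hand side of a rule; $M$ is (partial) deterministic if different rules have different left hand sides. $B$, $LB$, $DB$: classes of tree transformations realized by arbitrary, linear, deterministic bottom-up finite tree transducers. A bottom-up finite state relabeling is a bottom-up finite tree transducer all of whose rules have the form $a[q_1[x_1]\cdots q_k[x_k]]\to q[b[x_1\cdots x_k]]$ with $a\in\Sigma_k,b\in\Delta_k$,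 or $a\to q[b]$ with $a\in\Sigma_0,b\in\Delta_0$. $QREL$ is the class of tree transformations realized by bottom-up finite state relabelings, $DBQREL$ by deterministic ones. *)

theory Defs
  imports "HOL-Library.Infinite_Typeclass"
begin

text \<open>
  All symbols (input, output, intermediate symbols and states) are drawn from one universe
  \<open>'u\<close>; in the theorem \<open>'u\<close> is an arbitrary infinite type, so that fresh symbols always exist.
  A ranked alphabet is a finite set of pairs (symbol, rank); a symbol may have several ranks.
\<close>

type_synonym 'u ranked = "('u \<times> nat) set"

definition ranked_alphabet :: "'u ranked \<Rightarrow> bool" where
  "ranked_alphabet \<Sigma> \<longleftrightarrow> finite \<Sigma>"

text \<open>\<open>Var i\<close> is the variable \<open>x\<^sub>i\<close>; variables are numbered from 1.\<close>

datatype 'u tree = Var nat | Node 'u "'u tree list"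

text \<open>\<open>trees \<Sigma> k\<close> is \<open>T\<^sub>\<Sigma>(X\<^sub>k)\<close>; in particular \<open>trees \<Sigma> 0\<close> is \<open>T\<^sub>\<Sigma>\<close>.\<close>

inductive_set trees :: "'u ranked \<Rightarrow> nat \<Rightarrow> 'u tree set"
  for \<Sigma> :: "'u ranked" and k :: nat where
  Var: "1 \<le> i \<Longrightarrow> i \<le> k \<Longrightarrow> Var i \<in> trees \<Sigma> k"
| Node: "(a, length ts) \<in> \<Sigma> \<Longrightarrow> (\<And>t. t \<in> set ts \<Longrightarrow> t \<in> trees \<Sigma> k) \<Longrightarrow> Node a ts \<in> trees \<Sigma> k"

primrec subst :: "(nat \<Rightarrow> 'u tree) \<Rightarrow> 'u tree \<Rightarrow> 'u tree" where
  "subst \<phi> (Var i) = \<phi> i"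
| "subst \<phi> (Node a ts) = Node a (map (subst \<phi>) ts)"

primrec var_list :: "'u tree \<Rightarrow> nat list" where
  "var_list (Var i) = [i]"
| "var_list (Node a ts) = concat (map var_list ts)"

definition linear_tree :: "'u tree \<Rightarrow> bool" where
  "linear_tree t \<longleftrightarrow> distinct (var_list t)"

text \<open>
  A tree transformation from \<open>T\<^sub>\<Sigma>\<close> into \<open>T\<^sub>\<Delta>\<close> is represented as \<open>(\<Sigma>, \<Delta>, M)\<close> with
  \<open>M \<subseteq> T\<^sub>\<Sigma> \<times> T\<^sub>\<Delta>\<close>. Keeping the alphabets makes the composition of classes compose only
  transformations whose intermediate alphabets agree.
\<close>

type_synonym 'u transformation = "'u ranked \<times> 'u ranked \<times> ('u tree \<times> 'u tree) set"

definition comp_class ::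
    "'u transformation set \<Rightarrow> 'u transformation set \<Rightarrow> 'u transformation set" (infixr "\<circ>\<^sub>T" 75) where
  "F \<circ>\<^sub>T G = {(\<Sigma>, \<Omega>, M\<^sub>1 O M\<^sub>2) | \<Sigma> \<Delta> \<Omega> M\<^sub>1 M\<^sub>2. (\<Sigma>, \<Delta>, M\<^sub>1) \<in> F \<and> (\<Delta>, \<Omega>, M\<^sub>2) \<in> G}"


text \<open>In \<open>h k a\<close>, the index \<open>k\<close> is the rank at which the symbol \<open>a\<close> is used.\<close>

type_synonym 'u hom_family = "nat \<Rightarrow> 'u \<Rightarrow> 'u tree"

definition tree_hom :: "'u ranked \<Rightarrow> 'u ranked \<Rightarrow> 'u hom_family \<Rightarrow> bool" where
  "tree_hom \<Sigma> \<Delta> h \<longleftrightarrow>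
     ranked_alphabet \<Sigma> \<and> ranked_alphabet \<Delta> \<and> (\<forall>(a, k) \<in> \<Sigma>. h k a \<in> trees \<Delta> k)"

definition linear_hom :: "'u ranked \<Rightarrow> 'u hom_family \<Rightarrow> bool" where
  "linear_hom \<Sigma> h \<longleftrightarrow> (\<forall>(a, k) \<in> \<Sigma>. linear_tree (h k a))"

text \<open>The value on variables is irrelevant: only trees in \<open>T\<^sub>\<Sigma>\<close> are ever mapped.\<close>

primrec hom_apply :: "'u hom_family \<Rightarrow> 'u tree \<Rightarrow> 'u tree" where
  "hom_apply h (Var i) = Var i"
| "hom_apply h (Node a ts) = subst (\<lambda>i. map (hom_apply h) ts ! (i - 1)) (h (length ts) a)"

definition hom_graph :: "'u ranked \<Rightarrow> 'u hom_family \<Rightarrow> ('u tree \<times> 'u tree) set" where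
  "hom_graph \<Sigma> h = {(s, hom_apply h s) | s. s \<in> trees \<Sigma> 0}"

definition HOM :: "'u transformation set" where
  "HOM = {(\<Sigma>, \<Delta>, hom_graph \<Sigma> h) | \<Sigma> \<Delta> h. tree_hom \<Sigma> \<Delta> h}"

definition LHOM :: "'u transformation set" where
  "LHOM = {(\<Sigma>, \<Delta>, hom_graph \<Sigma> h) | \<Sigma> \<Delta> h. tree_hom \<Sigma> \<Delta> h \<and> linear_hom \<Sigma> h}"


text \<open>Rules are pairs (left hand side, right hand side).\<close>

record 'u bu_transducer =
  states :: "'u set"
  in_alph :: "'u ranked"
  out_alph :: "'u ranked"
  rules :: "('u tree \<times> 'u tree) set"
  final :: "'u set"

text \<open>\<open>lhs a qs\<close> is \<open>a[q\<^sub>1[x\<^sub>1]\<cdots>q\<^sub>k[x\<^sub>k]]\<close> for \<open>qs = [q\<^sub>1, \<dots>, q\<^sub>k]\<close>; it is \<open>a\<close> if \<open>k = 0\<close>.\<close>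

definition lhs :: "'u \<Rightarrow> 'u list \<Rightarrow> 'u tree" where
  "lhs a qs = Node a (map (\<lambda>i. Node (qs ! (i - 1)) [Var i]) [1..<length qs + 1])"

definition bu_rule :: "'u bu_transducer \<Rightarrow> 'u tree \<times> 'u tree \<Rightarrow> bool" where
  "bu_rule M r \<longleftrightarrow>
     (\<exists>a qs q t. r = (lhs a qs, Node q [t]) \<and> (a, length qs) \<in> in_alph M \<and>
        set qs \<subseteq> states M \<and> q \<in> states M \<and> t \<in> trees (out_alph M) (length qs))"

definition bu_transducer :: "'u bu_transducer \<Rightarrow> bool" where
  "bu_transducer M \<longleftrightarrow>
     ranked_alphabet (in_alph M) \<and> ranked_alphabet (out_alph M) \<and>
     finite (states M) \<and> states M \<inter> fst ` (in_alph M \<union> out_alph M) = {} \<and>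
     final M \<subseteq> states M \<and>
     finite (rules M) \<and> (\<forall>r \<in> rules M. bu_rule M r)"

text \<open>
  One rewriting step, applied at one occurrence of a subtree. The variables of a left hand side
  of rank \<open>k\<close> are exactly \<open>x\<^sub>1, \<dots>, x\<^sub>k\<close>, so the trees \<open>\<phi>\<^sub>1, \<dots>, \<phi>\<^sub>k\<close> are the values of \<open>\<phi>\<close> on these.
\<close>

inductive bu_step :: "'u bu_transducer \<Rightarrow> 'u tree \<Rightarrow> 'u tree \<Rightarrow> bool" for M :: "'u bu_transducer" where
  root: "(v, w) \<in> rules M \<Longrightarrow> (\<And>i. i \<in> set (var_list v) \<Longrightarrow> \<phi> i \<in> trees (out_alph M) 0) \<Longrightarrow>
           bu_step M (subst \<phi> v) (subst \<phi> w)"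
| subtree: "bu_step M s s' \<Longrightarrow> bu_step M (Node b (us @ s # vs)) (Node b (us @ s' # vs))"

definition realizes :: "'u bu_transducer \<Rightarrow> ('u tree \<times> 'u tree) set" where
  "realizes M = {(s, t). s \<in> trees (in_alph M) 0 \<and> t \<in> trees (out_alph M) 0 \<and>
     (\<exists>q \<in> final M. (bu_step M)\<^sup>*\<^sup>* s (Node q [t]))}"

definition linear_transducer :: "'u bu_transducer \<Rightarrow> bool" where
  "linear_transducer M \<longleftrightarrow> (\<forall>(v, w) \<in> rules M. linear_tree w)"

definition deterministic :: "'u bu_transducer \<Rightarrow> bool" where
  "deterministic M \<longleftrightarrow> (\<forall>r \<in> rules M. \<forall>r' \<in> rules M. r \<noteq> r' \<longrightarrow> fst r \<noteq> fst r')"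

definition relabeling :: "'u bu_transducer \<Rightarrow> bool" where
  "relabeling M \<longleftrightarrow> bu_transducer M \<and>
     (\<forall>r \<in> rules M. \<exists>a qs q b.
        r = (lhs a qs, Node q [Node b (map Var [1..<length qs + 1])]) \<and>
        (a, length qs) \<in> in_alph M \<and> (b, length qs) \<in> out_alph M)"

definition transformation_of :: "'u bu_transducer \<Rightarrow> 'u transformation" where
  "transformation_of M = (in_alph M, out_alph M, realizes M)"

definition BOT :: "'u transformation set" where
  "BOT = {transformation_of M | M. bu_transducer M}"

definition LBOT :: "'u transformation set" where
  "LBOT = {transformation_of M | M. bu_transducer M \<and> linear_transducer M}"

definition DBOT :: "'u transformation set" where
  "DBOT = {transformation_of M | M. bu_transducer M \<and> deterministic M}"

definition QREL :: "'u transformation set" where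
  "QREL = {transformation_of M | M. relabeling M}"

definition DBQREL :: "'u transformation set" where
  "DBQREL = {transformation_of M | M. relabeling M \<and> deterministic M}"

end

theory Submission
  imports Defs
begin

text \<open>
  Given a transducer \<open>M\<close>, pick a fresh symbol for each rule of \<open>M\<close>. The relabeling replaces the
  label of every node by the name of the rule that \<open>M\<close> applies there, keeping the states of \<open>M\<close>;
  the homomorphism then maps the name of a rule to the output tree of that rule. Linearity of
  the right hand sides carries over to the homomorphism. Determinism carries over to the
  relabeling, because the left hand sides are unchanged.
\<close>

section \<open>Trees and left hand sides\<close>

lemma Node_in_trees_iff:
  "Node a ts \<in> trees \<Sigma> k \<longleftrightarrow> (a, length ts) \<in> \<Sigma> \<and> (\<forall>t \<in> set ts. t \<in> trees \<Sigma> k)"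
  by (auto intro: trees.Node elim: trees.cases)

lemma Var_in_trees_iff: "Var i \<in> trees \<Sigma> k \<longleftrightarrow> 1 \<le> i \<and> i \<le> k"
  by (auto intro: trees.Var elim: trees.cases)

lemma trees_var_list: "t \<in> trees \<Sigma> k \<Longrightarrow> i \<in> set (var_list t) \<Longrightarrow> 1 \<le> i \<and> i \<le> k"
  by (induction rule: trees.induct) auto

lemma subst_cong: "(\<And>i. i \<in> set (var_list t) \<Longrightarrow> \<phi> i = \<psi> i) \<Longrightarrow> subst \<phi> t = subst \<psi> t"
  by (induction t) auto

text \<open>Variables count from 1 and list positions from 0; hence the form \<open>Suc i\<close>
  with \<open>i < k\<close>.\<close>

lemma subst_trees_cong:
  assumes "t \<in> trees \<Sigma> k" "\<And>i. i < k \<Longrightarrow> \<phi> (Suc i) = \<psi> (Suc i)"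
  shows "subst \<phi> t = subst \<psi> t"
proof (rule subst_cong)
  fix i assume "i \<in> set (var_list t)"
  with trees_var_list[OF assms(1)] have "1 \<le> i" "i \<le> k" by auto
  with assms(2)[of "i - 1"] show "\<phi> i = \<psi> i" by auto
qed

lemma subst_in_trees:
  "t \<in> trees \<Sigma> k \<Longrightarrow> (\<And>i. i < k \<Longrightarrow> \<phi> (Suc i) \<in> trees \<Sigma> m) \<Longrightarrow> subst \<phi> t \<in> trees \<Sigma> m"
proof (induction rule: trees.induct)
  case (Var i)
  then show ?case by (cases i) auto
qed (auto simp: Node_in_trees_iff)

lemma lhs_eq_iff: "lhs a qs = lhs b ps \<longleftrightarrow> a = b \<and> qs = ps"
proof
  assume eq: "lhs a qs = lhs b ps"
  have len: "length qs = length ps"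
    \<comment> \<open>\<open>case_tree\<close> acts as a projection, here to the number of children
      and below to the \<open>i\<close>-th child.\<close>
    using arg_cong[OF eq, of "case_tree (\<lambda>_. 0) (\<lambda>_ ts. length ts)"] by (simp add: lhs_def del: upt_Suc)
  have "qs ! i = ps ! i" if "i < length qs" for i
    using arg_cong[OF eq, of "case_tree (\<lambda>_. Var 0) (\<lambda>_ ts. ts ! i)"] that len
    by (simp add: lhs_def del: upt_Suc)
  with len eq show "a = b \<and> qs = ps"
    by (auto simp: lhs_def intro: nth_equalityI)
qed simp

lemma var_list_lhs: "set (var_list (lhs a qs)) = {1..length qs}"
  by (auto simp: lhs_def simp del: upt_Suc)

lemma subst_lhs:
  "subst \<phi> (lhs a qs) = Node a (map (\<lambda>i. Node (qs ! i) [\<phi> (Suc i)]) [0..<length qs])"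
  by (auto simp: lhs_def simp del: upt_Suc intro: nth_equalityI)

section \<open>Bottom-up evaluation\<close>

text \<open>
  \<open>derives M s q u\<close> evaluates \<open>s\<close> recursively. The first clause makes the relation meaningful on
  intermediate trees of a rewriting sequence as well, so that it is closed backwards under steps.
\<close>

inductive derives :: "'u bu_transducer \<Rightarrow> 'u tree \<Rightarrow> 'u \<Rightarrow> 'u tree \<Rightarrow> bool"
  for M :: "'u bu_transducer" where
  state: "q \<in> states M \<Longrightarrow> u \<in> trees (out_alph M) 0 \<Longrightarrow> derives M (Node q [u]) q u"
| rule: "(lhs a qs, Node q [t]) \<in> rules M \<Longrightarrow> length ss = length qs \<Longrightarrow> length us = length qs \<Longrightarrow>
     (\<And>i. i < length qs \<Longrightarrow> derives M (ss ! i) (qs ! i) (us ! i)) \<Longrightarrow>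
     derives M (Node a ss) q (subst (\<lambda>i. us ! (i - 1)) t)"

lemma bu_transducer_ruleE:
  assumes "bu_transducer M" "r \<in> rules M"
  obtains a qs q t where "r = (lhs a qs, Node q [t])" "(a, length qs) \<in> in_alph M"
    "set qs \<subseteq> states M" "q \<in> states M" "t \<in> trees (out_alph M) (length qs)"
  using assms unfolding bu_transducer_def bu_rule_def by blast

lemma bu_transducer_ruleD:
  assumes "bu_transducer M" "(lhs a qs, Node q [t]) \<in> rules M"
  shows "(a, length qs) \<in> in_alph M" "set qs \<subseteq> states M" "q \<in> states M"
    "t \<in> trees (out_alph M) (length qs)"
  using bu_transducer_ruleE[OF assms] by (auto simp: lhs_eq_iff)

text \<open>This separates the two clauses of \<open>derives\<close>: \<open>rule\<close> needs an
  input symbol at the root, \<open>state\<close> needs a state.\<close>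

lemma state_not_in_alph:
  assumes "bu_transducer M" "q \<in> states M"
  shows "(q, k) \<notin> in_alph M" "(q, k) \<notin> out_alph M"
  using assms unfolding bu_transducer_def by force+

lemma derives_in_trees:
  assumes "bu_transducer M" "derives M s q u"
  shows "u \<in> trees (out_alph M) 0"
  using assms(2)
proof induction
  case (rule a qs q t ss us)
  show ?case
    by (rule subst_in_trees[OF bu_transducer_ruleD(4)[OF assms(1) rule.hyps(1)]])
      (simp add: rule.IH)
qed

text \<open>A step leaves a state in the tree, and states are not output symbols.\<close>

lemma bu_step_result_not_in_trees:
  assumes "bu_transducer M" "bu_step M s s'"
  shows "s' \<notin> trees (out_alph M) k"
  using assms(2)
proof induction
  case (root v w \<phi>)
  obtain q t where "w = Node q [t]" "q \<in> states M"
    using bu_transducer_ruleE[OF assms(1) root(1)] by (metis prod.inject)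
  then show ?case using state_not_in_alph[OF assms(1)] by (auto simp: Node_in_trees_iff)
qed (auto simp: Node_in_trees_iff)

text \<open>Undoing a root step adds one use of clause \<open>rule\<close>, with children evaluated
  by clause \<open>state\<close>. A step below the root changes one child, whose evaluation the
  induction hypothesis carries back.\<close>

lemma derives_bu_step:
  assumes M: "bu_transducer M" and "bu_step M s s'" "derives M s' q u"
  shows "derives M s q u"
  using assms(2,3)
proof (induction arbitrary: q u)
  case (root v w \<phi>)
  obtain a qs p t where r: "v = lhs a qs" "w = Node p [t]" "(a, length qs) \<in> in_alph M"
    "set qs \<subseteq> states M" "p \<in> states M" "t \<in> trees (out_alph M) (length qs)"
    using bu_transducer_ruleE[OF M root(1)] by (metis prod.inject)
  have "derives M (Node p [subst \<phi> t]) q u" using root.prems r by simp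
  \<comment> \<open>The state \<open>p\<close> is not an input symbol, so only clause
    \<open>state\<close> can evaluate this tree.\<close>
  then have "q = p \<and> u = subst \<phi> t"
    using state_not_in_alph(1)[OF M r(5)]
    by cases (auto dest: bu_transducer_ruleD(1)[OF M])
  then have [simp]: "q = p" "u = subst \<phi> t" by auto
  have \<phi>: "\<phi> (Suc i) \<in> trees (out_alph M) 0" if "i < length qs" for i
    using root.hyps(2)[of "Suc i"] that by (auto simp: r(1) var_list_lhs)
  define us where "us = map (\<lambda>i. \<phi> (Suc i)) [0..<length qs]"
  have "derives M (Node a (map (\<lambda>i. Node (qs ! i) [\<phi> (Suc i)]) [0..<length qs])) p
      (subst (\<lambda>i. us ! (i - 1)) t)"
    using root.hyps(1) r(1,2,4) \<phi>
    by (intro derives.rule[where qs = qs]) (auto simp: us_def subset_iff intro: derives.state)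
  also have "subst (\<lambda>i. us ! (i - 1)) t = subst \<phi> t"
    by (rule subst_trees_cong[OF r(6)]) (simp add: us_def)
  finally show ?case by (simp add: r(1) subst_lhs)
next
  case (subtree s s' b xs ys)
  from subtree.prems show ?case
  proof (cases rule: derives.cases)
    case state
    \<comment> \<open>Clause \<open>state\<close> would make the rewritten child \<open>s'\<close>
      the output tree \<open>u\<close>, although the step left a state in it.\<close>
    then show ?thesis
      using bu_step_result_not_in_trees[OF M subtree.hyps] by (cases xs) auto
  next
    case (rule qs t us)
    have "derives M ((xs @ s # ys) ! i) (qs ! i) (us ! i)" if "i < length qs" for i
      using rule(5)[OF that] subtree.IH by (auto simp: nth_append nth_Cons' split: if_splits)
    then have "derives M (Node b (xs @ s # ys)) q (subst (\<lambda>i. us ! (i - 1)) t)"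
      using rule by (intro derives.rule[where qs = qs]) auto
    with rule show ?thesis by simp
  qed
qed

text \<open>The prefix \<open>us\<close> collects the siblings already rewritten, so the induction
  passes through the arguments from left to right.\<close>

lemma bu_step_rtranclp_args:
  "list_all2 (bu_step M)\<^sup>*\<^sup>* ss ss' \<Longrightarrow> (bu_step M)\<^sup>*\<^sup>* (Node a (us @ ss)) (Node a (us @ ss'))"
proof (induction arbitrary: us rule: list_all2_induct)
  case (Cons s ss s' ss')
  have "(bu_step M)\<^sup>*\<^sup>* (Node a (us @ s # ss)) (Node a (us @ s' # ss))"
    using Cons.hyps(1) by induction (auto intro: rtranclp.rtrancl_into_rtrancl bu_step.subtree)
  also have "(bu_step M)\<^sup>*\<^sup>* (Node a (us @ s' # ss)) (Node a (us @ s' # ss'))"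
    using Cons.IH[of "us @ [s']"] by simp
  finally show ?case .
qed simp

lemma derives_imp_bu_step:
  assumes "bu_transducer M" "derives M s q u"
  shows "(bu_step M)\<^sup>*\<^sup>* s (Node q [u])"
  using assms(2)
proof induction
  case (rule a qs q t ss us)
  define \<phi> where "\<phi> = (\<lambda>i. us ! (i - 1))"
  \<comment> \<open>Once every child is rewritten to a state above its output, the tree is an
    instance of the left hand side.\<close>
  have "(bu_step M)\<^sup>*\<^sup>* (Node a ss) (subst \<phi> (lhs a qs))"
    using bu_step_rtranclp_args[of M ss _ a "[]"] rule
    by (simp add: subst_lhs \<phi>_def list_all2_conv_all_nth)
  moreover have "bu_step M (subst \<phi> (lhs a qs)) (subst \<phi> (Node q [t]))"
    using rule.hyps(1)
  proof (rule bu_step.root)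
    fix i assume "i \<in> set (var_list (lhs a qs))"
    then show "\<phi> i \<in> trees (out_alph M) 0"
      using derives_in_trees[OF assms(1) rule.hyps(4), of "i - 1"]
      by (auto simp: \<phi>_def var_list_lhs)
  qed
  ultimately show ?case by (simp add: \<phi>_def)
qed simp

lemma realizes_iff_derives:
  assumes M: "bu_transducer M"
  shows "(s, u) \<in> realizes M \<longleftrightarrow> s \<in> trees (in_alph M) 0 \<and> (\<exists>q \<in> final M. derives M s q u)"
proof -
  have "derives M s q u" if "(bu_step M)\<^sup>*\<^sup>* s (Node q [u])" "u \<in> trees (out_alph M) 0" "q \<in> final M" for q
    using that(1)
  \<comment> \<open>Walk the rewriting sequence backwards from \<open>Node q [u]\<close>, which
    clause \<open>state\<close> evaluates to \<open>u\<close>.\<close>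
  proof (induction rule: converse_rtranclp_induct)
    case base
    show ?case using that M by (auto simp: bu_transducer_def intro: derives.state)
  qed (rule derives_bu_step[OF M])
  then show ?thesis
    using derives_imp_bu_step[OF M] derives_in_trees[OF M] unfolding realizes_def by blast
qed

section \<open>Factoring a transducer through its rules\<close>

definition rule_rank :: "'u tree \<times> 'u tree \<Rightarrow> nat" where
  "rule_rank r = (case fst r of Var i \<Rightarrow> 0 | Node a ts \<Rightarrow> length ts)"

definition rule_state :: "'u tree \<times> 'u tree \<Rightarrow> 'u" where
  "rule_state r = (case snd r of Node q ts \<Rightarrow> q)"

definition rule_output :: "'u tree \<times> 'u tree \<Rightarrow> 'u tree" where
  "rule_output r = (case snd r of Node q ts \<Rightarrow> hd ts)"

lemma rule_components [simp]:
  "rule_rank (lhs a qs, w) = length qs"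
  "rule_state (v, Node q [t]) = q"
  "rule_output (v, Node q [t]) = t"
  by (simp_all add: rule_rank_def rule_state_def rule_output_def lhs_def del: upt_Suc)

definition relabel_rule :: "('u tree \<times> 'u tree \<Rightarrow> 'u) \<Rightarrow> 'u tree \<times> 'u tree \<Rightarrow> 'u tree \<times> 'u tree" where
  "relabel_rule c r =
     (fst r, Node (rule_state r) [Node (c r) (map Var [1..<rule_rank r + 1])])"

definition rule_relabeling ::
    "('u tree \<times> 'u tree \<Rightarrow> 'u) \<Rightarrow> 'u bu_transducer \<Rightarrow> 'u bu_transducer" where
  "rule_relabeling c M = \<lparr>states = states M, in_alph = in_alph M,
     out_alph = (\<lambda>r. (c r, rule_rank r)) ` rules M,
     rules = relabel_rule c ` rules M, final = final M\<rparr>"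

definition rule_hom :: "('u tree \<times> 'u tree \<Rightarrow> 'u) \<Rightarrow> 'u bu_transducer \<Rightarrow> 'u hom_family" where
  "rule_hom c M k b = rule_output (inv_into (rules M) c b)"

lemma rule_relabeling_sel [simp]:
  "states (rule_relabeling c M) = states M"
  "in_alph (rule_relabeling c M) = in_alph M"
  "out_alph (rule_relabeling c M) = (\<lambda>r. (c r, rule_rank r)) ` rules M"
  "rules (rule_relabeling c M) = relabel_rule c ` rules M"
  "final (rule_relabeling c M) = final M"
  by (simp_all add: rule_relabeling_def)

text \<open>Distinct relabeled rules come from distinct rules of \<open>M\<close>, whose left hand
  sides they keep.\<close>

lemma deterministic_rule_relabeling: "deterministic M \<Longrightarrow> deterministic (rule_relabeling c M)"
  unfolding deterministic_def by (force simp: relabel_rule_def)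

text \<open>Injectivity lets the homomorphism recover a rule from its name. Names must avoid the
  states because they become the output symbols of the relabeling; they may coincide with symbols of
  the alphabets of \<open>M\<close>.\<close>

locale rule_naming =
  fixes M :: "'u bu_transducer" and c :: "'u tree \<times> 'u tree \<Rightarrow> 'u"
  assumes transducer: "bu_transducer M"
    and inj_naming: "inj_on c (rules M)"
    and naming_fresh: "c ` rules M \<inter> states M = {}"
begin

abbreviation N where "N \<equiv> rule_relabeling c M"
abbreviation h where "h \<equiv> rule_hom c M"

lemma rule_hom_naming: "r \<in> rules M \<Longrightarrow> h k (c r) = rule_output r"
  by (simp add: rule_hom_def inj_naming)

lemma relabeling_rule_relabeling: "relabeling N"
proof -
  \<comment> \<open>Proved once for two uses: the rules of \<open>N\<close> are transducer rules,
    and they have the shape of a relabeling.\<close>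
  have rule: "\<exists>a qs q. r = (lhs a qs, Node q [Node b (map Var [1..<length qs + 1])]) \<and>
      (a, length qs) \<in> in_alph N \<and> (b, length qs) \<in> out_alph N \<and>
      set qs \<subseteq> states N \<and> q \<in> states N"
    if "r0 \<in> rules M" and r: "r = relabel_rule c r0" "b = c r0" for r r0 b
    using bu_transducer_ruleE[OF transducer that(1)]
  proof cases
    case (1 a qs q t)
    then show ?thesis using that(1) unfolding r
      by (intro exI[of _ a] exI[of _ qs] exI[of _ q])
        (auto simp: relabel_rule_def intro!: image_eqI[where x = r0] simp del: upt_Suc)
  qed
  have "bu_rule N r" if "r \<in> rules N" for r
  proof -
    from that obtain r0 where "r0 \<in> rules M" "r = relabel_rule c r0" by auto
    from rule[OF this refl] obtain a qs q
      where q: "r = (lhs a qs, Node q [Node (c r0) (map Var [1..<length qs + 1])])"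
        "(a, length qs) \<in> in_alph N" "set qs \<subseteq> states N" "q \<in> states N"
        "(c r0, length qs) \<in> out_alph N"
      by blast
    from q(5) have "Node (c r0) (map Var [1..<length qs + 1]) \<in> trees (out_alph N) (length qs)"
      by (auto simp: Node_in_trees_iff Var_in_trees_iff simp del: upt_Suc rule_relabeling_sel)
    with q(1-4) show ?thesis unfolding bu_rule_def by blast
  qed
  moreover have "finite (rules M)" "ranked_alphabet (in_alph M)" "finite (states M)"
    "final M \<subseteq> states M" "states M \<inter> fst ` in_alph M = {}"
    using transducer by (auto simp: bu_transducer_def)
  ultimately have "bu_transducer N"
    using naming_fresh by (auto simp: bu_transducer_def ranked_alphabet_def)
  moreover have "\<exists>a qs q b. r = (lhs a qs, Node q [Node b (map Var [1..<length qs + 1])]) \<and>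
        (a, length qs) \<in> in_alph N \<and> (b, length qs) \<in> out_alph N" if "r \<in> rules N" for r
  proof -
    from that obtain r0 where "r0 \<in> rules M" "r = relabel_rule c r0" by auto
    from rule[OF this refl] show ?thesis by blast
  qed
  ultimately show ?thesis by (auto simp: relabeling_def)
qed

lemma tree_hom_rule_hom: "tree_hom (out_alph N) (out_alph M) h"
proof -
  have "h (rule_rank r) (c r) \<in> trees (out_alph M) (rule_rank r)" if "r \<in> rules M" for r
    using bu_transducer_ruleE[OF transducer that] rule_hom_naming[OF that] by force
  then show ?thesis
    using transducer by (auto simp: tree_hom_def ranked_alphabet_def bu_transducer_def)
qed

lemma linear_hom_rule_hom:
  assumes "linear_transducer M"
  shows "linear_hom (out_alph N) h"
proof -
  have "linear_tree (h (rule_rank r) (c r))" if "r \<in> rules M" for r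
    using bu_transducer_ruleE[OF transducer that]
  proof cases
    case (1 a qs q t)
    then have "linear_tree (Node q [t])"
      using assms that by (auto simp: linear_transducer_def)
    then show ?thesis
      using rule_hom_naming[OF that] 1(1) by (simp add: linear_tree_def)
  qed
  then show ?thesis by (auto simp: linear_hom_def)
qed

text \<open>The witness \<open>u\<close> is the tree of names of the rules applied. Deleted subtrees
  are still evaluated, and copies are made only after evaluation, so one name per node of
  \<open>s\<close> records everything.\<close>

lemma derives_imp_derives_rule_relabeling:
  assumes "s \<in> trees (in_alph M) 0" "derives M s q t"
  shows "\<exists>u. derives N s q u \<and> t = hom_apply h u"
  using assms
proof (induction arbitrary: q t rule: trees.induct)
  case (Node a ss)
  from Node.prems show ?case
  proof (cases rule: derives.cases)
    case state
    then show ?thesis using Node.hyps state_not_in_alph(1)[OF transducer] by auto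
  next
    case (rule qs t' ts)
    have "\<exists>u. derives N (ss ! i) (qs ! i) u \<and> ts ! i = hom_apply h u" if "i < length qs" for i
      using rule(3,5) that by (intro Node.IH) auto
    then obtain u where u: "\<And>i. i < length qs \<Longrightarrow> derives N (ss ! i) (qs ! i) (u i)"
      "\<And>i. i < length qs \<Longrightarrow> ts ! i = hom_apply h (u i)" by metis
    define us where "us = map u [0..<length qs]"
    let ?r = "(lhs a qs, Node q [t'])"
    let ?w = "Node (c ?r) (map Var [1..<length qs + 1])"
    have "(lhs a qs, Node q [?w]) \<in> rules N"
      using rule(2) by (auto simp: relabel_rule_def intro!: image_eqI[where x = ?r])
    then have "derives N (Node a ss) q (subst (\<lambda>i. us ! (i - 1)) ?w)"
      using rule(3) u(1) by (intro derives.rule[where qs = qs]) (auto simp: us_def)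
    \<comment> \<open>The variables stand in order, so the substitution just hangs the relabeled
      children under the name.\<close>
    moreover have "subst (\<lambda>i. us ! (i - 1)) ?w = Node (c ?r) us"
      by (auto simp: us_def simp del: upt_Suc intro!: nth_equalityI)
    \<comment> \<open>The homomorphism replaces the name by \<open>t'\<close> and fills in the
      images \<open>ts ! i\<close>; the two substitutions agree on the variables that can occur in
      \<open>t'\<close>.\<close>
    moreover have "t = hom_apply h (Node (c ?r) us)"
      using u(2) bu_transducer_ruleD(4)[OF transducer rule(2)]
      by (auto simp: rule(1) rule_hom_naming[OF rule(2)] us_def intro!: subst_trees_cong)
    ultimately show ?thesis by metis
  qed
qed auto

text \<open>A rule of \<open>N\<close> keeps the left hand side and target state of its origin
  \<open>r\<close>, and its label \<open>c r\<close> decodes to the output of \<open>r\<close>, so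
  the evaluation can be replayed in \<open>M\<close>.\<close>

lemma derives_rule_relabeling_imp_derives:
  assumes "s \<in> trees (in_alph M) 0" "derives N s q u"
  shows "derives M s q (hom_apply h u)"
  using assms
proof (induction arbitrary: q u rule: trees.induct)
  case (Node a ss)
  from Node.prems show ?case
  proof (cases rule: derives.cases)
    case state
    then show ?thesis using Node.hyps state_not_in_alph(1)[OF transducer] by auto
  next
    case (rule qs w us)
    from rule(2) obtain r where r: "r \<in> rules M" "(lhs a qs, Node q [w]) = relabel_rule c r"
      by auto
    obtain t where t: "r = (lhs a qs, Node q [t])" "w = Node (c r) (map Var [1..<length qs + 1])"
      using bu_transducer_ruleE[OF transducer r(1)]
    proof cases
      case (1 b ps p t)
      then show thesis
        using r(2) that[of t] by (simp add: relabel_rule_def lhs_eq_iff del: upt_Suc)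
    qed
    have u: "u = Node (c r) us"
      using rule(4) by (auto simp: rule(1) t(2) simp del: upt_Suc intro!: nth_equalityI)
    have "derives M (Node a ss) q (subst (\<lambda>i. map (hom_apply h) us ! (i - 1)) t)"
      using r(1) rule(3-5) Node.IH unfolding t(1) by (intro derives.rule[where qs = qs]) auto
    then show ?thesis by (simp add: u rule_hom_naming[OF r(1)], simp add: t(1))
  qed
qed auto

lemma realizes_factorization: "realizes M = realizes N O hom_graph (out_alph N) h"
proof -
  have N: "bu_transducer N" using relabeling_rule_relabeling by (simp add: relabeling_def)
  show ?thesis
  proof (rule set_eqI, clarify)
    fix s t
    \<comment> \<open>\<open>derives_in_trees\<close> for \<open>N\<close> puts the intermediate
      tree into the domain of \<open>hom_graph\<close>.\<close>
    show "(s, t) \<in> realizes M \<longleftrightarrow> (s, t) \<in> realizes N O hom_graph (out_alph N) h"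
      using derives_imp_derives_rule_relabeling derives_rule_relabeling_imp_derives
        derives_in_trees[OF N]
      by (fastforce simp: realizes_iff_derives[OF N] realizes_iff_derives[OF transducer]
          hom_graph_def relcomp_unfold)
  qed
qed

lemma transformation_of_factorization:
  assumes "transformation_of N \<in> F" "(out_alph N, out_alph M, hom_graph (out_alph N) h) \<in> G"
  shows "transformation_of M \<in> F \<circ>\<^sub>T G"
  using assms realizes_factorization unfolding transformation_of_def comp_class_def by auto

end

text \<open>The complement of the finite set of states is infinite, hence contains as many symbols
  as there are rules; a bijection onto them is the naming.\<close>

lemma rule_naming_exists:
  fixes M :: "'u::infinite bu_transducer"
  assumes "bu_transducer M"
  obtains c where "rule_naming M c"
proof -
  have fin: "finite (rules M)" "finite (states M)" using assms by (auto simp: bu_transducer_def)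
  have "infinite (- states M)"
    using fin(2) infinite_UNIV by (simp add: Compl_eq_Diff_UNIV)
  then obtain B where B: "B \<subseteq> - states M" "finite B" "card B = card (rules M)"
    using infinite_arbitrarily_large by blast
  then obtain c where "bij_betw c (rules M) B"
    using finite_same_card_bij[OF fin(1)] by metis
  then have "rule_naming M c"
    using B(1) assms by unfold_locales (auto simp: bij_betw_def)
  then show thesis by (rule that)
qed

theorem theorem4p52:
  shows "(BOT :: 'u::infinite transformation set) \<subseteq> QREL \<circ>\<^sub>T HOM
    \<and> (LBOT :: 'u transformation set) \<subseteq> QREL \<circ>\<^sub>T LHOM
    \<and> (DBOT :: 'u transformation set) \<subseteq> DBQREL \<circ>\<^sub>T HOM"
proof -
  \<comment> \<open>One factorization serves all three inclusions: linearity passes to the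
    homomorphism, determinism to the relabeling.\<close>
  have "transformation_of M \<in> QREL \<circ>\<^sub>T HOM
      \<and> (linear_transducer M \<longrightarrow> transformation_of M \<in> QREL \<circ>\<^sub>T LHOM)
      \<and> (deterministic M \<longrightarrow> transformation_of M \<in> DBQREL \<circ>\<^sub>T HOM)"
    if M: "bu_transducer M" for M :: "'u bu_transducer"
  proof -
    obtain c where "rule_naming M c" using rule_naming_exists[OF M] .
    then interpret rule_naming M c .
    have "transformation_of N \<in> QREL"
      using relabeling_rule_relabeling unfolding QREL_def by blast
    moreover have "deterministic M \<Longrightarrow> transformation_of N \<in> DBQREL"
      using relabeling_rule_relabeling deterministic_rule_relabeling unfolding DBQREL_def by blast
    moreover have "(out_alph N, out_alph M, hom_graph (out_alph N) h) \<in> HOM"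
      using tree_hom_rule_hom unfolding HOM_def by blast
    moreover have "linear_transducer M \<Longrightarrow>
        (out_alph N, out_alph M, hom_graph (out_alph N) h) \<in> LHOM"
      using tree_hom_rule_hom linear_hom_rule_hom unfolding LHOM_def by blast
    ultimately show ?thesis using transformation_of_factorization by blast
  qed
  then show ?thesis unfolding BOT_def LBOT_def DBOT_def by blast
qed

end
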